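(* (Dynamic regret of inexact online gradient descent with relative error.) Let $p\ge1$, $L>0$, $\alpha\ge0$. For every $t\ge0$ let $0<m_t\le L_t$, $\sigma_t\ge0$, $0<\delta_t<\frac{2m_t}{L_t+m_t}$, $\alpha\le\frac{2}{(1+\delta_t)L_t}$, and let $f_t\in\mathcal S(m_t,L_t)$ be $L$-smooth with global minimizer $x_t^*\in\mathbb R^p$. Consider $x_{t+1}=x_t-\alpha(\nabla f_t(x_t)+v_t)$ and assume $\|x_{t+1}^*-x_t^*\|\le\sigma_t$ and $\|v_t\|\le\delta_t\|\nabla f_t(x_t)\|$ for all $t$. Suppose $\hat\rho_t=\hat\rho$ for all $t$, with $\hat\rho<1$, where $\hat\rho_t$ is defined in the context, and let $\hat U_0=\|x_0-x_0^*\|^2$. Then for every $T\ge0$, $$\sum_{t=0}^T\left(f_t(x_t)-f_t(x_t^* )\right)\le\frac{L}{(1-\hat\rho)^2}\hat U_0+\frac{L}{(1-\hat\rho)^2}\left(\sum_{t=0}^{T-1}\sigma_t\right)^2.$$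
   Context: $\mathcal S(m,L)$ is the set of differentiable functions $f:\mathbb R^p\to\mathbb R$ having a unique global minimizer $x^*$ such that for all $x\in\mathbb R^p$ $$\begin{bmatrix}x-x^*\\ \nabla f(x)\end{bmatrix}^T\begin{bmatrix}-2mLI_p&(L+m)I_p\\(L+m)I_p&-2I_p\end{bmatrix}\begin{bmatrix}x-x^*\\ \nabla f(x)\end{bmatrix}\ge0.$$ With $\alpha_{t_-}:=\frac{1}{1-\delta_t}\left(\frac{2}{L_t+m_t}-\frac{\delta_t}{m_t}\right)$ and $\alpha_{t_+}:=\frac{1}{1+\delta_t}\left(\frac{2}{L_t+m_t}+\frac{\delta_t}{L_t}\right)$, $$\hat\rho_t:=\begin{cases}1-\alpha m_t(1-\delta_t)&\text{if }0\le\alpha\le\alpha_{t_-},\\ \left(1-\frac{2\alpha L_tm_t}{L_t+m_t}+\frac{\alpha\delta_t^2(L_t+m_t-2\alpha L_tm_t)}{2-\alpha(L_t+m_t)}\right)^{1/2}&\text{if }\alpha_{t_-}<\alpha<\alpha_{t_+},\\ (1+\delta_t)\alpha L_t-1&\text{if }\alpha_{t_+}\le\alpha\le\frac{2}{(1+\delta_t)L_t}.\end{cases}$$ $f$ is $L$-smooth if $\nabla f$ is $L$-Lipschitz. Empty sums are zero. *)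

theory Defs
  imports "HOL-Analysis.Analysis"
begin

text \<open>Meaningful only where \<open>f\<close> is differentiable; there the Riesz representative of the
  derivative is unique.\<close>

definition gradient :: "(real^'p \<Rightarrow> real) \<Rightarrow> real^'p \<Rightarrow> real^'p" where
  "gradient f x = (THE g. GDERIV f x :> g)"

lemma gradient_eqI:
  assumes "GDERIV f x :> g"
  shows "gradient f x = g"
proof -
  have "h = g" if "GDERIV f x :> h" for h
  proof -
    have "(\<lambda>y. y \<bullet> h) = (\<lambda>y. y \<bullet> g)"
      using that assms unfolding gderiv_def by (rule has_derivative_unique)
    then have "\<forall>y. y \<bullet> h = y \<bullet> g" by metis
    then show "h = g" by (metis inner_commute vector_eq_ldot)
  qed
  with assms show ?thesis unfolding gradient_def by blast
qed

lemma GDERIV_gradient: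
  assumes "f differentiable (at x)"
  shows "GDERIV f x :> gradient f x"
proof -
  obtain f' where f': "(f has_derivative f') (at x)"
    using assms unfolding differentiable_def by blast
  then have lin: "linear f'" by (rule has_derivative_linear)
  have "f' = (\<lambda>y. y \<bullet> adjoint f' 1)"
    using adjoint_works[OF lin, of _ 1] by (simp add: fun_eq_iff)
  then have "GDERIV f x :> adjoint f' 1"
    using f' unfolding gderiv_def by simp
  then show ?thesis using gradient_eqI by metis
qed

definition block_vec :: "real^'p \<Rightarrow> real^'p \<Rightarrow> real^('p + 'p)" where
  "block_vec u w = (\<chi> i. case i of Inl k \<Rightarrow> u $ k | Inr k \<Rightarrow> w $ k)"

definition block_mat ::
  "real^'p^'p \<Rightarrow> real^'p^'p \<Rightarrow> real^'p^'p \<Rightarrow> real^'p^'p \<Rightarrow> real^('p + 'p)^('p + 'p)" where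
  "block_mat A B C D =
     (\<chi> i j. case i of
        Inl k \<Rightarrow> (case j of Inl l \<Rightarrow> A $ k $ l | Inr l \<Rightarrow> B $ k $ l)
      | Inr k \<Rightarrow> (case j of Inl l \<Rightarrow> C $ k $ l | Inr l \<Rightarrow> D $ k $ l))"

definition sector_mat :: "real \<Rightarrow> real \<Rightarrow> real^('p::finite + 'p)^('p + 'p)" where
  "sector_mat m L =
     block_mat (mat (- 2 * m * L)) (mat (L + m))
               (mat (L + m))       (mat (- 2))"

lemma block_vec_inner:
  "block_vec a b \<bullet> block_vec c d = a \<bullet> c + b \<bullet> d"
  by (simp add: block_vec_def inner_vec_def UNIV_Plus_UNIV[symmetric] sum.Plus
           del: UNIV_Plus_UNIV)

lemma block_mat_mult_vec:
  "block_mat A B C D *v block_vec u w = block_vec (A *v u + B *v w) (C *v u + D *v w)"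
  by (simp add: block_vec_def block_mat_def matrix_vector_mult_def vec_eq_iff
        UNIV_Plus_UNIV[symmetric] sum.Plus split: sum.split del: UNIV_Plus_UNIV)

lemma mat_mult_vec: "mat c *v (u :: real^'p) = c *\<^sub>R u"
  by (simp add: mat_def matrix_vector_mult_def vec_eq_iff if_distrib if_distribR cong: if_cong)

lemma sector_form:
  "block_vec u w \<bullet> (sector_mat m L *v block_vec u w)
     = - 2 * m * L * (u \<bullet> u) + 2 * (L + m) * (u \<bullet> w) - 2 * (w \<bullet> w)"
  by (simp add: sector_mat_def block_mat_mult_vec block_vec_inner mat_mult_vec
        inner_add_right inner_commute algebra_simps)

definition global_minimizer :: "(real^'p \<Rightarrow> real) \<Rightarrow> real^'p \<Rightarrow> bool" where
  "global_minimizer f z \<longleftrightarrow> (\<forall>y. f z \<le> f y)"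

definition sector_class :: "real \<Rightarrow> real \<Rightarrow> (real^'p \<Rightarrow> real) set" where
  "sector_class m L =
     {f. (\<forall>x. f differentiable (at x)) \<and>
         (\<exists>z. global_minimizer f z \<and> (\<forall>y. global_minimizer f y \<longrightarrow> y = z) \<and>
              (\<forall>x. 0 \<le> block_vec (x - z) (gradient f x)
                       \<bullet> (sector_mat m L *v block_vec (x - z) (gradient f x))))}"

definition L_smooth :: "real \<Rightarrow> (real^'p \<Rightarrow> real) \<Rightarrow> bool" where
  "L_smooth L f \<longleftrightarrow> (\<forall>x. f differentiable (at x)) \<and> L-lipschitz_on UNIV (gradient f)"

definition alpha_minus :: "real \<Rightarrow> real \<Rightarrow> real \<Rightarrow> real" where
  "alpha_minus m L \<delta> = 1 / (1 - \<delta>) * (2 / (L + m) - \<delta> / m)"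

definition alpha_plus :: "real \<Rightarrow> real \<Rightarrow> real \<Rightarrow> real" where
  "alpha_plus m L \<delta> = 1 / (1 + \<delta>) * (2 / (L + m) + \<delta> / L)"

text \<open>Intended for \<open>0 < m \<le> L\<close>, \<open>0 < \<delta> < 2 * m / (L + m)\<close> and
  \<open>0 \<le> \<alpha> \<le> 2 / ((1 + \<delta>) * L)\<close>. There \<open>alpha_minus m L \<delta> \<le> alpha_plus m L \<delta>\<close>, and
  the denominator of the middle branch is positive on that branch. If the two thresholds
  coincide and \<open>\<alpha>\<close> equals them, then \<open>m = L\<close> and \<open>\<alpha> = 1 / L\<close>, so the two outer
  branches agree and their order does not matter.\<close>

definition rho_hat :: "real \<Rightarrow> real \<Rightarrow> real \<Rightarrow> real \<Rightarrow> real" where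
  "rho_hat \<alpha> m L \<delta> =
     (if \<alpha> \<le> alpha_minus m L \<delta> then 1 - \<alpha> * m * (1 - \<delta>)
      else if \<alpha> < alpha_plus m L \<delta> then
        sqrt (1 - 2 * \<alpha> * L * m / (L + m)
                + \<alpha> * \<delta>\<^sup>2 * (L + m - 2 * \<alpha> * L * m) / (2 - \<alpha> * (L + m)))
      else (1 + \<delta>) * \<alpha> * L - 1)"

end

theory Submission
  imports Defs
begin

text \<open>Write \<open>U = norm (x - z)\<close>, \<open>R = norm (\<nabla>f x)\<close>. The sector condition and Cauchy-Schwarz give
  \<open>m U \<le> R \<le> L U\<close> and \<open>norm (x - z - \<alpha> \<nabla>f x)\<^sup>2 \<le> A U\<^sup>2 - c R\<^sup>2\<close> with
  \<open>A = 1 - 2 \<alpha> m L / (L + m)\<close> and \<open>c = \<alpha> (2 / (L + m) - \<alpha>)\<close>. The error contributes at most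
  \<open>\<alpha> \<delta> R\<close>, so for \<open>U = 1\<close> one step contracts by the maximum of \<open>sqrt (A - c R\<^sup>2) + \<alpha> \<delta> R\<close>
  over \<open>m \<le> R \<le> L\<close>; it is attained at \<open>m\<close>, in the interior, or at \<open>L\<close>, which are the three
  branches of \<open>rho_hat\<close>. Hence the distances \<open>d t\<close> to the minimizers satisfy
  \<open>d (Suc t) \<le> \<rho> d t + \<sigma> t\<close>, so that
  \<open>\<Sum>d t \<le> (d 0 + \<Sum>\<sigma> t) / (1 - \<rho>)\<close>. Conclude with \<open>f x - f z \<le> L / 2 U\<^sup>2\<close>,
  \<open>\<Sum>(d t)\<^sup>2 \<le> (\<Sum>d t)\<^sup>2\<close> and \<open>(a + b)\<^sup>2 \<le> 2 a\<^sup>2 + 2 b\<^sup>2\<close>.\<close>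

section \<open>Consequences of the sector condition\<close>

text \<open>Uniqueness within the class identifies the existentially bound minimizer with the given
  \<open>z\<close>; the inequality is half the quadratic form.\<close>

lemma sector_class_minimizer:
  assumes "f \<in> sector_class m L" and "global_minimizer f z"
  shows "m * L * (norm (x - z))\<^sup>2 + (norm (gradient f x))\<^sup>2 \<le> (L + m) * ((x - z) \<bullet> gradient f x)"
proof -
  have "0 \<le> block_vec (x - z) (gradient f x)
              \<bullet> (sector_mat m L *v block_vec (x - z) (gradient f x))"
    using assms unfolding sector_class_def by blast
  then show ?thesis
    by (simp add: sector_form power2_norm_eq_inner algebra_simps)
qed

lemma gradient_minimizer_eq_0:
  assumes "f \<in> sector_class m L" and "global_minimizer f z"
  shows "gradient f z = 0"
  using sector_class_minimizer[OF assms, of z] by simp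

text \<open>Cauchy-Schwarz turns the condition into a product
  \<open>0 \<le> (norm w - m * norm u) * (L * norm u - norm w)\<close>. Since
  \<open>m * norm u \<le> L * norm u\<close>, one negative factor would force the other to be
  positive.\<close>

lemma sector_norm_bounds:
  fixes u w :: "'a::real_inner"
  assumes "0 < m" "m \<le> L"
    and sec: "m * L * (norm u)\<^sup>2 + (norm w)\<^sup>2 \<le> (L + m) * (u \<bullet> w)"
  shows "m * norm u \<le> norm w" and "norm w \<le> L * norm u"
proof -
  have "(L + m) * (u \<bullet> w) \<le> (L + m) * (norm u * norm w)"
    using assms by (intro mult_left_mono norm_cauchy_schwarz) auto
  with sec have prod: "0 \<le> (norm w - m * norm u) * (L * norm u - norm w)"
    by (simp add: algebra_simps power2_eq_square)
  have le: "m * norm u \<le> L * norm u"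
    using assms by (intro mult_right_mono) auto
  show "m * norm u \<le> norm w"
  proof (rule ccontr)
    assume "\<not> ?thesis"
    then have "(norm w - m * norm u) * (L * norm u - norm w) < 0"
      using le by (intro mult_neg_pos) auto
    with prod show False by simp
  qed
  show "norm w \<le> L * norm u"
  proof (rule ccontr)
    assume "\<not> ?thesis"
    then have "(norm w - m * norm u) * (L * norm u - norm w) < 0"
      using le by (intro mult_pos_neg) auto
    with prod show False by simp
  qed
qed

section \<open>Contraction in one step, branch by branch\<close>

text \<open>Expand the square and bound the cross term \<open>u \<bullet> w\<close> from below by
  the sector condition.\<close>

lemma exact_step_bound:
  fixes u w :: "'a::real_inner"
  assumes "0 < m" "m \<le> L" "0 \<le> \<alpha>"
    and sec: "m * L * (norm u)\<^sup>2 + (norm w)\<^sup>2 \<le> (L + m) * (u \<bullet> w)"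
  shows "(norm (u - \<alpha> *\<^sub>R w))\<^sup>2
           \<le> (1 - 2 * \<alpha> * L * m / (L + m)) * (norm u)\<^sup>2 - \<alpha> * (2 / (L + m) - \<alpha>) * (norm w)\<^sup>2"
proof -
  have "(m * L * (norm u)\<^sup>2 + (norm w)\<^sup>2) / (L + m) \<le> u \<bullet> w"
    using assms by (simp add: pos_divide_le_eq mult.commute)
  then have "2 * \<alpha> * ((m * L * (norm u)\<^sup>2 + (norm w)\<^sup>2) / (L + m)) \<le> 2 * \<alpha> * (u \<bullet> w)"
    using assms by (intro mult_left_mono) auto
  moreover have "(norm (u - \<alpha> *\<^sub>R w))\<^sup>2 = (norm u)\<^sup>2 - 2 * \<alpha> * (u \<bullet> w) + \<alpha>\<^sup>2 * (norm w)\<^sup>2"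
    unfolding power2_norm_eq_inner
    by (simp add: inner_diff_left inner_diff_right inner_commute power2_eq_square algebra_simps)
  ultimately show ?thesis
    by (simp add: algebra_simps add_divide_distrib power2_eq_square)
qed

text \<open>In the two outer branches the square root is bounded by its tangent at the endpoint, where
  \<open>A - c r\<^sup>2 = q\<^sup>2\<close>; the case \<open>q = 0\<close> only occurs if \<open>m = L\<close>.\<close>

lemma rho_hat_lower_branch:
  fixes U R :: real
  assumes m: "0 < m" "m \<le> L" and \<delta>: "0 < \<delta>" "\<delta> < 2 * m / (L + m)"
    and \<alpha>: "0 \<le> \<alpha>" "\<alpha> \<le> alpha_minus m L \<delta>"
    and R: "m * U \<le> R" "R \<le> L * U" and U: "0 \<le> U"
    and a: "a\<^sup>2 \<le> (1 - 2 * \<alpha> * L * m / (L + m)) * U\<^sup>2 - \<alpha> * (2 / (L + m) - \<alpha>) * R\<^sup>2"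
  shows "a + \<alpha> * \<delta> * R \<le> (1 - \<alpha> * m * (1 - \<delta>)) * U"
proof -
  define c where "c = \<alpha> * (2 / (L + m) - \<alpha>)"
  define q where "q = 1 - \<alpha> * m"
  have "2 * m / (L + m) \<le> 1" using m by simp
  with \<delta> have \<delta>1: "\<delta> < 1" by simp
  have \<alpha>m: "\<alpha> * m * (1 - \<delta>) \<le> 2 * m / (L + m) - \<delta>"
  proof -
    have "\<alpha> * (1 - \<delta>) \<le> 2 / (L + m) - \<delta> / m"
      using \<alpha>(2) \<delta>1 unfolding alpha_minus_def by (simp add: pos_le_divide_eq)
    then have "\<alpha> * (1 - \<delta>) * m \<le> (2 / (L + m) - \<delta> / m) * m"
      using m by (intro mult_right_mono) auto
    moreover have "(2 / (L + m) - \<delta> / m) * m = 2 * m / (L + m) - \<delta>"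
      using m by (simp add: left_diff_distrib)
    ultimately show ?thesis by (simp add: mult_ac)
  qed
  \<comment> \<open>Scaling \<delta> by a number at most 1 exposes the common factor
    \<open>1 - \<delta>\<close>. Cancelling it leads to \<open>\<alpha> \<le> 2 / (L + m)\<close>,
    hence \<open>0 \<le> c\<close>.\<close>
  have "2 * m / (L + m) - \<delta> \<le> 2 * m / (L + m) - \<delta> * (2 * m / (L + m))"
    using \<open>2 * m / (L + m) \<le> 1\<close> \<delta> mult_left_mono[of "2 * m / (L + m)" 1 \<delta>] by simp
  then have "\<alpha> * m * (1 - \<delta>) \<le> 2 * m / (L + m) * (1 - \<delta>)"
    using \<alpha>m by (simp add: algebra_simps diff_divide_distrib)
  then have \<alpha>m2: "\<alpha> * m \<le> 2 * m / (L + m)"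
    using \<delta>1 by (simp only: mult_le_cancel_right)
  have "\<alpha> \<le> 2 / (L + m)" 
    using \<alpha>m2 m mult_le_cancel_right_pos[of m \<alpha> "2 / (L + m)"] by simp
  then have c: "0 \<le> c" using \<alpha> by (simp add: c_def)
  have q: "0 \<le> q" using \<alpha>m2 \<open>2 * m / (L + m) \<le> 1\<close> by (simp add: q_def)
  have Aq: "1 - 2 * \<alpha> * L * m / (L + m) = q\<^sup>2 + c * m\<^sup>2"
    using m by (simp add: c_def q_def field_simps power2_eq_square)
  have a': "a\<^sup>2 \<le> q\<^sup>2 * U\<^sup>2 - c * (R\<^sup>2 - (m * U)\<^sup>2)"
    using a unfolding c_def[symmetric] Aq by (simp add: algebra_simps power_mult_distrib)
  have "a \<le> q * U - \<alpha> * \<delta> * (R - m * U)"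
  \<comment> \<open>The strict case excludes \<open>U = 0\<close> and \<open>m = L\<close>, so
    \<open>q * U\<close> is positive and can be cancelled at the end.\<close>
  proof (cases "R = m * U")
    case True
    then have "a\<^sup>2 \<le> (q * U)\<^sup>2" using a' by (simp add: power_mult_distrib)
    then have "a \<le> q * U" by (rule power2_le_imp_le) (simp add: q U)
    then show ?thesis using True by simp
  next
    case False
    then have lt: "m * U < R" using R by simp
    have "0 < U" using lt R U by (cases "U = 0") auto
    have "m < L" using lt R \<open>0 < U\<close> by (metis less_le_trans mult_less_cancel_right_pos)
    then have "2 * m / (L + m) < 1" using m by simp
    with \<alpha>m2 have "0 < q" by (simp add: q_def)
    \<comment> \<open>The bound by \<open>alpha_minus\<close>, rearranged. Multiplied by \<alpha>,
      it says that the square root plus \<open>\<alpha> * \<delta> * R\<close> has slope at most 0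
      at \<open>R = m * U\<close>.\<close>
    have "\<delta> * q \<le> (2 / (L + m) - \<alpha>) * m"
      using \<alpha>m by (simp add: q_def algebra_simps)
    then have "2 * U * \<alpha> * (\<delta> * q) \<le> 2 * U * \<alpha> * ((2 / (L + m) - \<alpha>) * m)"
      using \<alpha> U by (intro mult_left_mono) auto
    then have "2 * q * U * \<alpha> * \<delta> \<le> c * (2 * (m * U))"
      by (simp only: c_def mult_ac)
    also have "\<dots> \<le> c * (R + m * U)" using c lt by (intro mult_left_mono) linarith+
    finally have "2 * q * U * \<alpha> * \<delta> * (R - m * U) \<le> c * (R + m * U) * (R - m * U)"
      using lt by (intro mult_right_mono) auto
    also have "\<dots> = c * (R\<^sup>2 - (m * U)\<^sup>2)" by (simp add: algebra_simps power2_eq_square)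
    finally have "a\<^sup>2 + (q * U)\<^sup>2 \<le> 2 * q * U * (q * U) - 2 * q * U * \<alpha> * \<delta> * (R - m * U)"
      using a' by (simp add: power_mult_distrib power2_eq_square algebra_simps)
    \<comment> \<open>This inequality serves as the tangent estimate, so no square root has to be
      differentiated.\<close>
    moreover have "2 * q * U * a \<le> a\<^sup>2 + (q * U)\<^sup>2"
      using sum_squares_bound[of a "q * U"] by (simp add: mult_ac)
    ultimately have "2 * q * U * a \<le> 2 * q * U * (q * U - \<alpha> * \<delta> * (R - m * U))"
      by (simp add: algebra_simps)
    then show ?thesis using \<open>0 < q\<close> \<open>0 < U\<close> by (simp add: mult_le_cancel_left_pos)
  qed
  then show ?thesis by (simp add: q_def algebra_simps)
qed

lemma rho_hat_upper_branch:
  fixes U R :: real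
  assumes m: "0 < m" "m \<le> L" and \<delta>: "0 < \<delta>"
    and \<alpha>: "0 \<le> \<alpha>" "alpha_plus m L \<delta> \<le> \<alpha>"
    and R: "m * U \<le> R" "R \<le> L * U" and U: "0 \<le> U"
    and a: "a\<^sup>2 \<le> (1 - 2 * \<alpha> * L * m / (L + m)) * U\<^sup>2 - \<alpha> * (2 / (L + m) - \<alpha>) * R\<^sup>2"
  shows "a + \<alpha> * \<delta> * R \<le> ((1 + \<delta>) * \<alpha> * L - 1) * U"
proof -
  define c where "c = \<alpha> * (2 / (L + m) - \<alpha>)"
  define q where "q = \<alpha> * L - 1"
  have L: "0 < L" using m by simp
  have L1: "1 \<le> 2 * L / (L + m)" using m by simp
  have "alpha_plus m L \<delta> * (1 + \<delta>) = 2 / (L + m) + \<delta> / L"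
    using \<delta> by (simp add: alpha_plus_def)
  then have "alpha_plus m L \<delta> * (L * (1 + \<delta>)) = (2 / (L + m) + \<delta> / L) * L"
    by (metis mult.commute mult.assoc)
  also have "\<dots> = 2 * L / (L + m) + \<delta>"
    using L by (simp add: distrib_right)
  finally have "alpha_plus m L \<delta> * (L * (1 + \<delta>)) = 2 * L / (L + m) + \<delta>" .
  moreover have "alpha_plus m L \<delta> * (L * (1 + \<delta>)) \<le> \<alpha> * (L * (1 + \<delta>))"
    using \<alpha>(2) L \<delta> by (intro mult_right_mono) auto
  ultimately have \<alpha>L: "2 * L / (L + m) + \<delta> \<le> \<alpha> * L * (1 + \<delta>)" by (simp add: mult.assoc)
  have ge1: "1 \<le> \<alpha> * L" and gt1: "m < L \<Longrightarrow> 1 < \<alpha> * L"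
  proof -
    have "1 * (1 + \<delta>) \<le> \<alpha> * L * (1 + \<delta>)" using \<alpha>L L1 by simp
    then show "1 \<le> \<alpha> * L" using \<delta> by (simp only: mult_le_cancel_right)
    assume "m < L"
    then have "1 < 2 * L / (L + m)" using m by simp
    then have "1 * (1 + \<delta>) < \<alpha> * L * (1 + \<delta>)" using \<alpha>L by simp
    then show "1 < \<alpha> * L" using \<delta> by (simp only: mult_less_cancel_right)
  qed
  have q: "0 \<le> q" using ge1 by (simp add: q_def)
  have Aq: "1 - 2 * \<alpha> * L * m / (L + m) = q\<^sup>2 + c * L\<^sup>2"
    using m by (simp add: c_def q_def field_simps power2_eq_square)
  have a': "a\<^sup>2 \<le> q\<^sup>2 * U\<^sup>2 + c * ((L * U)\<^sup>2 - R\<^sup>2)"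
    using a unfolding c_def[symmetric] Aq by (simp add: algebra_simps power_mult_distrib)
  have "a \<le> q * U + \<alpha> * \<delta> * (L * U - R)"
  proof (cases "R = L * U")
    case True
    then have "a\<^sup>2 \<le> (q * U)\<^sup>2" using a' by (simp add: power_mult_distrib)
    then have "a \<le> q * U" by (rule power2_le_imp_le) (simp add: q U)
    then show ?thesis using True by simp
  next
    case False
    then have lt: "R < L * U" using R by simp
    have "0 < U" using lt R U by (cases "U = 0") auto
    have "m < L" using lt R \<open>0 < U\<close> by (metis le_less_trans mult_less_cancel_right_pos)
    then have "0 < q" using gt1 by (simp add: q_def)
    have "0 \<le> R" using R m U by (meson mult_nonneg_nonneg less_imp_le order_trans)
    \<comment> \<open>The mirrored slope condition: at \<open>R = L * U\<close> the slope is at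
      least 0 because \<alpha> is beyond \<open>alpha_plus\<close>.\<close>
    have "(2 / (L + m) - \<alpha>) * L \<le> \<delta> * q"
      using \<alpha>L by (simp add: q_def algebra_simps)
    then have "2 * U * \<alpha> * ((2 / (L + m) - \<alpha>) * L) \<le> 2 * U * \<alpha> * (\<delta> * q)"
      using \<alpha> U by (intro mult_left_mono) auto
    then have cL: "c * (2 * (L * U)) \<le> 2 * q * U * \<alpha> * \<delta>"
      by (simp only: c_def mult_ac)
    have "c * (L * U + R) \<le> 2 * q * U * \<alpha> * \<delta>"
    \<comment> \<open>Here \<alpha> may exceed \<open>2 / (L + m)\<close>, making \<open>c\<close>
      negative; the left side is then at most 0.\<close>
    proof (cases "0 \<le> c")
      case True
      then have "c * (L * U + R) \<le> c * (2 * (L * U))" using lt by (intro mult_left_mono) auto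
      then show ?thesis using cL by simp
    next
      case False
      then have "c * (L * U + R) \<le> 0"
        using \<open>0 \<le> R\<close> lt by (intro mult_nonpos_nonneg) auto
      also have "0 \<le> 2 * q * U * \<alpha> * \<delta>" using q U \<alpha> \<delta> by simp
      finally show ?thesis .
    qed
    then have "c * (L * U + R) * (L * U - R) \<le> 2 * q * U * \<alpha> * \<delta> * (L * U - R)"
      using lt by (intro mult_right_mono) auto
    moreover have "c * (L * U + R) * (L * U - R) = c * ((L * U)\<^sup>2 - R\<^sup>2)"
      by (simp add: algebra_simps power2_eq_square)
    ultimately have "a\<^sup>2 + (q * U)\<^sup>2 \<le> 2 * q * U * (q * U) + 2 * q * U * \<alpha> * \<delta> * (L * U - R)"
      using a' by (simp add: power_mult_distrib power2_eq_square algebra_simps)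
    moreover have "2 * q * U * a \<le> a\<^sup>2 + (q * U)\<^sup>2"
      using sum_squares_bound[of a "q * U"] by (simp add: mult_ac)
    ultimately have "2 * q * U * a \<le> 2 * q * U * (q * U + \<alpha> * \<delta> * (L * U - R))"
      by (simp add: algebra_simps)
    then show ?thesis using \<open>0 < q\<close> \<open>0 < U\<close> by (simp add: mult_le_cancel_left_pos)
  qed
  then show ?thesis by (simp add: q_def algebra_simps)
qed

text \<open>Cauchy-Schwarz for the pairs \<open>(a, sqrt c * R)\<close> and
  \<open>(1, \<alpha> * \<delta> / sqrt c)\<close> gives the maximum over all
  \<open>R\<close>.\<close>

lemma rho_hat_middle_branch:
  fixes U R :: real
  assumes m: "0 < m" "m \<le> L" and \<delta>: "0 < \<delta>"
    and \<alpha>: "0 < \<alpha>" "\<alpha> < alpha_plus m L \<delta>" and U: "0 \<le> U"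
    and a: "a\<^sup>2 \<le> (1 - 2 * \<alpha> * L * m / (L + m)) * U\<^sup>2 - \<alpha> * (2 / (L + m) - \<alpha>) * R\<^sup>2"
  shows "a + \<alpha> * \<delta> * R
           \<le> sqrt (1 - 2 * \<alpha> * L * m / (L + m)
                + \<alpha> * \<delta>\<^sup>2 * (L + m - 2 * \<alpha> * L * m) / (2 - \<alpha> * (L + m))) * U"
    (is "_ \<le> sqrt ?E * U")
proof -
  define A where "A = 1 - 2 * \<alpha> * L * m / (L + m)"
  define c where "c = \<alpha> * (2 / (L + m) - \<alpha>)"
  \<comment> \<open>This puts \<open>alpha_plus\<close> below \<open>2 / (L + m)\<close>, so that
    \<open>c\<close> and the denominator of the radicand are positive.\<close>
  have "1 / L \<le> 2 / (L + m)" using m by (simp add: field_simps)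
  then have "2 / (L + m) + \<delta> * (1 / L) \<le> 2 / (L + m) + \<delta> * (2 / (L + m))"
    using \<delta> by (intro add_left_mono mult_left_mono) auto
  then have "2 / (L + m) + \<delta> / L \<le> 2 / (L + m) * (1 + \<delta>)"
    by (simp add: distrib_left mult.commute add_divide_distrib)
  then have "alpha_plus m L \<delta> \<le> 2 / (L + m)"
    unfolding alpha_plus_def using \<delta> by (simp add: pos_divide_le_eq)
  with \<alpha> have lt: "\<alpha> < 2 / (L + m)" by simp
  then have c: "0 < c" using \<alpha> by (simp add: c_def)
  have pos: "0 < 2 - \<alpha> * (L + m)" using lt m by (simp add: field_simps)
  have "\<alpha>\<^sup>2 * \<delta>\<^sup>2 / c = \<alpha> * \<delta>\<^sup>2 * (L + m) / (2 - \<alpha> * (L + m))"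
  proof -
    have "c = \<alpha> * (2 - \<alpha> * (L + m)) / (L + m)"
      using m by (simp add: c_def field_simps)
    then show ?thesis using pos m \<alpha> by (simp add: power2_eq_square)
  qed
  moreover have "A * (L + m) = L + m - 2 * \<alpha> * L * m"
    using m by (simp add: A_def field_simps)
  ultimately have "A * (\<alpha>\<^sup>2 * \<delta>\<^sup>2 / c)
      = \<alpha> * \<delta>\<^sup>2 * (L + m - 2 * \<alpha> * L * m) / (2 - \<alpha> * (L + m))"
    by (metis mult.commute mult.assoc times_divide_eq_right)
  then have E: "?E = A * (1 + \<alpha>\<^sup>2 * \<delta>\<^sup>2 / c)"
    by (simp only: A_def distrib_left mult.right_neutral)
  \<comment> \<open>This quotient is exactly the defect in the Cauchy-Schwarz inequality.\<close>
  have "0 \<le> (\<alpha> * \<delta> * a - c * R)\<^sup>2 / c" using c by simp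
  also have "(\<alpha> * \<delta> * a - c * R)\<^sup>2 / c
      = (a\<^sup>2 + c * R\<^sup>2) * (1 + \<alpha>\<^sup>2 * \<delta>\<^sup>2 / c) - (a + \<alpha> * \<delta> * R)\<^sup>2"
    using c by (simp add: field_simps power2_eq_square)
  finally have "(a + \<alpha> * \<delta> * R)\<^sup>2 \<le> (a\<^sup>2 + c * R\<^sup>2) * (1 + \<alpha>\<^sup>2 * \<delta>\<^sup>2 / c)"
    by simp
  also have "\<dots> \<le> A * U\<^sup>2 * (1 + \<alpha>\<^sup>2 * \<delta>\<^sup>2 / c)"
    using a c unfolding A_def[symmetric] c_def[symmetric]
    by (intro mult_right_mono) auto
  also have "\<dots> = ?E * U\<^sup>2" by (simp add: E)
  finally have "a + \<alpha> * \<delta> * R \<le> sqrt (?E * U\<^sup>2)" by (rule real_le_rsqrt)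
  also have "\<dots> = sqrt ?E * U" using U by (simp add: real_sqrt_mult)
  finally show ?thesis .
qed

lemma inexact_step_contraction:
  fixes u w e :: "'a::real_inner"
  assumes m: "0 < m" "m \<le> L" and \<delta>: "0 < \<delta>" "\<delta> < 2 * m / (L + m)" and \<alpha>: "0 \<le> \<alpha>"
    and sec: "m * L * (norm u)\<^sup>2 + (norm w)\<^sup>2 \<le> (L + m) * (u \<bullet> w)"
    and e: "norm e \<le> \<delta> * norm w"
  shows "norm (u - \<alpha> *\<^sub>R (w + e)) \<le> rho_hat \<alpha> m L \<delta> * norm u"
proof -
  note R = sector_norm_bounds[OF m sec]
  note a = exact_step_bound[OF m \<alpha> sec]
  have "norm (u - \<alpha> *\<^sub>R (w + e)) = norm ((u - \<alpha> *\<^sub>R w) - \<alpha> *\<^sub>R e)"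
    by (simp add: algebra_simps)
  also have "\<dots> \<le> norm (u - \<alpha> *\<^sub>R w) + \<alpha> * norm e"
    using norm_triangle_ineq4[of "u - \<alpha> *\<^sub>R w" "\<alpha> *\<^sub>R e"] \<alpha> by simp
  also have "\<dots> \<le> norm (u - \<alpha> *\<^sub>R w) + \<alpha> * \<delta> * norm w"
    using mult_left_mono[OF e \<alpha>] by (simp add: mult.assoc)
  also have "\<dots> \<le> rho_hat \<alpha> m L \<delta> * norm u"
  proof -
    consider "\<alpha> \<le> alpha_minus m L \<delta>"
      | "\<not> \<alpha> \<le> alpha_minus m L \<delta>" "\<alpha> < alpha_plus m L \<delta>"
      | "\<not> \<alpha> \<le> alpha_minus m L \<delta>" "\<not> \<alpha> < alpha_plus m L \<delta>" by blast
    then show ?thesis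
    proof cases
      case 1
      then show ?thesis
        using rho_hat_lower_branch[OF m \<delta> \<alpha> 1 R norm_ge_zero a] by (simp add: rho_hat_def)
    next
      case 2
      have "2 * m / (L + m) \<le> 1" using m by simp
      then have "\<delta> < 1" using \<delta> by simp
      \<comment> \<open>The upper bound on \<delta> makes \<open>alpha_minus\<close> positive, which
        rules out \<open>\<alpha> = 0\<close> and hence \<open>c = 0\<close> in this branch.\<close>
      moreover have "\<delta> / m < 2 / (L + m)"
        using \<delta>(2) m by (simp add: pos_divide_less_eq mult.commute)
      ultimately have "0 < alpha_minus m L \<delta>" by (simp add: alpha_minus_def)
      then have "0 < \<alpha>" using 2 by simp
      from rho_hat_middle_branch[OF m \<delta>(1) this 2(2) norm_ge_zero a] show ?thesis
        using 2 by (simp add: rho_hat_def)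
    next
      case 3
      then show ?thesis
        using rho_hat_upper_branch[OF m \<delta>(1) \<alpha> _ R norm_ge_zero a] by (simp add: rho_hat_def)
    qed
  qed
  finally show ?thesis .
qed

section \<open>From distances to function values, and summation over time\<close>

text \<open>The descent lemma at a stationary point: along the segment from \<open>z\<close> to
  \<open>x\<close>, \<open>f\<close> minus the quadratic has nonpositive derivative.\<close>

lemma L_smooth_quadratic_upper_bound:
  fixes f :: "real^'p \<Rightarrow> real"
  assumes "L_smooth L f" and "gradient f z = 0"
  shows "f x - f z \<le> L / 2 * (norm (x - z))\<^sup>2"
proof -
  define u where "u = x - z"
  define g where "g s = f (z + s *\<^sub>R u) - L / 2 * s\<^sup>2 * (norm u)\<^sup>2" for s
  have "\<exists>y. (g has_real_derivative y) (at s) \<and> y \<le> 0" if s: "0 \<le> s" "s \<le> 1" for s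
  proof -
    let ?G = "gradient f (z + s *\<^sub>R u)"
    have "(f has_derivative (\<lambda>h. h \<bullet> ?G)) (at (z + s *\<^sub>R u))"
      using assms GDERIV_gradient unfolding L_smooth_def gderiv_def by blast
    then have "((\<lambda>s. f (z + s *\<^sub>R u)) has_derivative (\<lambda>h. (h *\<^sub>R u) \<bullet> ?G)) (at s)"
      by (rule has_derivative_compose[rotated]) (auto intro!: derivative_eq_intros)
    then have "((\<lambda>s. f (z + s *\<^sub>R u)) has_real_derivative u \<bullet> ?G) (at s)"
      by (rule has_derivative_imp_has_field_derivative) simp
    then have "(g has_real_derivative u \<bullet> ?G - L * s * (norm u)\<^sup>2) (at s)"
      unfolding g_def by (auto intro!: derivative_eq_intros)
    moreover have "u \<bullet> ?G - L * s * (norm u)\<^sup>2 \<le> 0"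
    proof -
      \<comment> \<open>The gradient vanishes at \<open>z\<close>, so the Lipschitz bound controls
        the gradient itself.\<close>
      have "norm ?G \<le> L * (s * norm u)"
        using assms s lipschitz_onD[of L UNIV "gradient f" "z + s *\<^sub>R u" z]
        by (simp add: L_smooth_def dist_norm)
      then have "norm u * norm ?G \<le> norm u * (L * (s * norm u))"
        by (intro mult_left_mono) auto
      then show ?thesis
        using norm_cauchy_schwarz[of u ?G] by (simp add: power2_eq_square mult_ac)
    qed
    ultimately show ?thesis by blast
  qed
  then have "g 1 \<le> g 0"
    by (intro DERIV_nonpos_imp_nonincreasing[of 0 1 g]) auto
  then show ?thesis by (simp add: g_def u_def)
qed

text \<open>Summing the recursion bounds the sum by \<rho> times itself plus data; solving for it
  avoids unrolling geometric weights.\<close>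

lemma sum_perturbed_contraction_le:
  fixes d \<sigma> :: "nat \<Rightarrow> real"
  assumes d: "\<And>t. 0 \<le> d t" and step: "\<And>t. d (Suc t) \<le> \<rho> * d t + \<sigma> t" and "0 \<le> \<rho>" "\<rho> < 1"
  shows "(\<Sum>t\<le>T. d t) \<le> (d 0 + (\<Sum>t<T. \<sigma> t)) / (1 - \<rho>)"
proof -
  have "(\<Sum>t\<le>T. d t) = d 0 + (\<Sum>t<T. d (Suc t))"
    by (metis lessThan_Suc_atMost sum.lessThan_Suc_shift)
  also have "\<dots> \<le> d 0 + (\<Sum>t<T. \<rho> * d t + \<sigma> t)"
    by (intro add_left_mono sum_mono step)
  also have "\<dots> = d 0 + \<rho> * (\<Sum>t<T. d t) + (\<Sum>t<T. \<sigma> t)"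
    by (simp add: sum.distrib sum_distrib_left)
  \<comment> \<open>Adding the nonnegative term \<open>\<rho> * d T\<close> makes the same sum
    appear on both sides.\<close>
  also have "\<dots> \<le> d 0 + \<rho> * (\<Sum>t\<le>T. d t) + (\<Sum>t<T. \<sigma> t)"
    using d \<open>0 \<le> \<rho>\<close> by (intro add_mono mult_left_mono sum_mono2) auto
  finally show ?thesis using \<open>\<rho> < 1\<close> by (simp add: field_simps)
qed

text \<open>One factor of each square is bounded by the whole sum.\<close>

lemma sum_power2_le_power2_sum:
  fixes d :: "'b \<Rightarrow> real"
  assumes "\<And>t. t \<in> I \<Longrightarrow> 0 \<le> d t"
  shows "(\<Sum>t\<in>I. (d t)\<^sup>2) \<le> (\<Sum>t\<in>I. d t)\<^sup>2"
proof (cases "finite I")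
  case True
  have "(\<Sum>t\<in>I. d t * d t) \<le> (\<Sum>t\<in>I. d t * (\<Sum>s\<in>I. d s))"
    using assms True by (intro sum_mono mult_left_mono member_le_sum) auto
  then show ?thesis by (simp add: power2_eq_square sum_distrib_right)
qed simp

section \<open>Assembly of the regret bound\<close>

theorem mainTheorem16:
  fixes f :: "nat \<Rightarrow> real^'p \<Rightarrow> real"
    and x xstar v :: "nat \<Rightarrow> real^'p"
    and m Lt \<sigma> \<delta> :: "nat \<Rightarrow> real"
    and L \<alpha> \<rho> :: real
    and T :: nat
  assumes "L > 0" and "\<alpha> \<ge> 0"
    and "\<And>t. 0 < m t" and "\<And>t. m t \<le> Lt t"
    and "\<And>t. \<sigma> t \<ge> 0"
    and "\<And>t. 0 < \<delta> t" and "\<And>t. \<delta> t < 2 * m t / (Lt t + m t)"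
    and "\<And>t. \<alpha> \<le> 2 / ((1 + \<delta> t) * Lt t)"
    and "\<And>t. f t \<in> sector_class (m t) (Lt t)"
    and "\<And>t. L_smooth L (f t)"
    and "\<And>t. global_minimizer (f t) (xstar t)"
    and "\<And>t. x (Suc t) = x t - \<alpha> *\<^sub>R (gradient (f t) (x t) + v t)"
    and "\<And>t. norm (xstar (Suc t) - xstar t) \<le> \<sigma> t"
    and "\<And>t. norm (v t) \<le> \<delta> t * norm (gradient (f t) (x t))"
    and "\<And>t. rho_hat \<alpha> (m t) (Lt t) (\<delta> t) = \<rho>"
    and "\<rho> < 1"
  shows "(\<Sum>t=0..T. f t (x t) - f t (xstar t))
           \<le> L / (1 - \<rho>)\<^sup>2 * (norm (x 0 - xstar 0))\<^sup>2 + L / (1 - \<rho>)\<^sup>2 * (\<Sum>t<T. \<sigma> t)\<^sup>2"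
proof -
  define d where "d t = norm (x t - xstar t)" for t
  define S where "S = (\<Sum>t<T. \<sigma> t)"
  have d: "0 \<le> d t" for t by (simp add: d_def)
  have contr: "norm (x (Suc t) - xstar t) \<le> \<rho> * d t" for t
  proof -
    have "x (Suc t) - xstar t = x t - xstar t - \<alpha> *\<^sub>R (gradient (f t) (x t) + v t)"
      by (simp add: assms(12))
    then show ?thesis
      unfolding d_def
      using inexact_step_contraction[OF assms(3,4,6,7,2) sector_class_minimizer[OF assms(9,11)]
          assms(14), of t]
      by (simp only: assms(15))
  qed
  have step: "d (Suc t) \<le> \<rho> * d t + \<sigma> t" for t
  proof -
    have "d (Suc t) \<le> norm (x (Suc t) - xstar t) + norm (xstar (Suc t) - xstar t)"
      unfolding d_def
      using norm_triangle_ineq4[of "x (Suc t) - xstar t" "xstar (Suc t) - xstar t"] by simp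
    then show ?thesis using contr[of t] assms(13)[of t] by linarith
  qed
  have S: "0 \<le> S" unfolding S_def using assms(5) by (simp add: sum_nonneg)
  have sum_d: "(\<Sum>t\<le>T. d t) \<le> (d 0 + S) / (1 - \<rho>)"
  proof (cases "0 \<le> \<rho>")
    case True
    then show ?thesis
      using sum_perturbed_contraction_le[of d, OF d step True assms(16)] by (simp add: S_def)
  next
    case False
    \<comment> \<open>A negative factor forces every iterate to be a minimizer.\<close>
    have "d t = 0" for t
    proof -
      have "0 \<le> \<rho> * d t" using contr[of t] norm_ge_zero order_trans by blast
      then show ?thesis using False d[of t] by (simp add: zero_le_mult_iff)
    qed
    then show ?thesis using S assms(16) by simp
  qed
  have "(\<Sum>t=0..T. f t (x t) - f t (xstar t)) \<le> (\<Sum>t=0..T. L / 2 * (d t)\<^sup>2)"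
    unfolding d_def
    by (intro sum_mono L_smooth_quadratic_upper_bound assms(10)
        gradient_minimizer_eq_0[OF assms(9,11)])
  also have "\<dots> = L / 2 * (\<Sum>t\<le>T. (d t)\<^sup>2)"
    by (simp add: sum_distrib_left atLeast0AtMost)
  also have "\<dots> \<le> L / 2 * (\<Sum>t\<le>T. d t)\<^sup>2"
    using assms(1) d by (intro mult_left_mono sum_power2_le_power2_sum) auto
  also have "\<dots> \<le> L / 2 * ((d 0 + S) / (1 - \<rho>))\<^sup>2"
    using assms(1) d sum_d by (intro mult_left_mono power_mono sum_nonneg) auto
  also have "\<dots> = L / (1 - \<rho>)\<^sup>2 * ((d 0 + S)\<^sup>2 / 2)"
    by (simp add: power_divide)
  \<comment> \<open>The \<open>1 / 2\<close> from smoothness absorbs the factor 2 lost in splitting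
    the square.\<close>
  also have "\<dots> \<le> L / (1 - \<rho>)\<^sup>2 * ((d 0)\<^sup>2 + S\<^sup>2)"
    using assms(1) sum_squares_bound[of "d 0" S]
    by (intro mult_left_mono) (auto simp: power2_sum)
  finally show ?thesis by (simp add: d_def S_def distrib_left)
qed

end
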